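(* For each odd prime $p$ there exists a local nearring $R$ whose additive group $R^+$ is isomorphic to $G_5=C_p\times(C_{p^2}\rtimes C_p)$, the group of order $p^4$ with presentation $$G_5=\langle a,b,c \colon a^{p^2}=b^p=c^p=[a,c]=[b,c]=e,\ [b,a]=a^p\rangle.$$
   Context: A (left) nearring is a non-empty set $R$ with two binary operations $+$ and $\cdot$ such that $(R,+)$ is a (not necessarily abelian) group with neutral element $0$, $(R,\cdot)$ is a semigroup, and $x\cdot(y+z)=x\cdot y+x\cdot z$ for all $x,y,z\in R$. The group $(R,+)$ is denoted $R^+$ and called the additive group of $R$. $R$ is a nearring with identity if $(R,\cdot)$ is a monoid. A nearring $R$ with identity is local if the set $L$ of all elements of $R$ that are not invertible in the monoid $(R,\cdot)$ is a subgroup of $R^+$. $C_n$ is the cyclic group of order $n$, and $[\cdot,\cdot]$ denotes the group commutator (the two usual commutator conventions give isomorphic groups here). Written additively, $G_5$ is generated by $a,b,c$ with relations $ap^2=bp=cp=0$, $a+b=b+a(1-p)$, $a+c=c+a$, $b+c=c+b$. *)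

theory Defs
  imports
    "HOL-Algebra.Ring"
    "HOL-Algebra.Bij"
    "HOL-Algebra.Elementary_Groups"
    "HOL-Computational_Algebra.Primes"
begin

section \<open>Local nearrings\<close>

text \<open>
  The record type of rings is reused for the operations. The field \<open>one\<close> is only constrained once an
  identity is required; the additive group is \<open>add_monoid R\<close>.
\<close>

locale nearring =
  fixes R (structure)
  assumes add_group: "group (add_monoid R)"
    and mult_closed: "\<lbrakk>x \<in> carrier R; y \<in> carrier R\<rbrakk> \<Longrightarrow> x \<otimes> y \<in> carrier R"
    and mult_assoc: "\<lbrakk>x \<in> carrier R; y \<in> carrier R; z \<in> carrier R\<rbrakk>
          \<Longrightarrow> (x \<otimes> y) \<otimes> z = x \<otimes> (y \<otimes> z)"
    and left_distrib: "\<lbrakk>x \<in> carrier R; y \<in> carrier R; z \<in> carrier R\<rbrakk>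
          \<Longrightarrow> x \<otimes> (y \<oplus> z) = x \<otimes> y \<oplus> x \<otimes> z"

locale nearring_with_identity = nearring +
  assumes mult_monoid: "monoid R"

locale local_nearring = nearring_with_identity +
  assumes nonunits_subgroup: "subgroup (carrier R - Units R) (add_monoid R)"

section \<open>Groups given by generators and relations\<close>

text \<open>
  The generators are the elements of the type \<open>'g\<close>. In a word, \<open>(g, True)\<close> stands for the generator
  \<open>g\<close> and \<open>(g, False)\<close> for its formal inverse.
\<close>

type_synonym 'g word = "('g \<times> bool) list"

definition gen :: "'g \<Rightarrow> 'g word" where
  "gen g = [(g, True)]"

definition word_inv :: "'g word \<Rightarrow> 'g word" where
  "word_inv w = rev (map (\<lambda>(g, s). (g, \<not> s)) w)"

definition word_pow :: "'g word \<Rightarrow> nat \<Rightarrow> 'g word" where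
  "word_pow w n = concat (replicate n w)"

definition word_comm :: "'g word \<Rightarrow> 'g word \<Rightarrow> 'g word" where
  "word_comm u v = word_inv u @ word_inv v @ u @ v"

inductive word_eq :: "'g word set \<Rightarrow> 'g word \<Rightarrow> 'g word \<Rightarrow> bool" for rels where
  refl: "word_eq rels u u"
| sym: "word_eq rels u v \<Longrightarrow> word_eq rels v u"
| trans: "word_eq rels u v \<Longrightarrow> word_eq rels v w \<Longrightarrow> word_eq rels u w"
| cancel: "word_eq rels (u @ [(g, s), (g, \<not> s)] @ v) (u @ v)"
| relator: "r \<in> rels \<Longrightarrow> word_eq rels (u @ r @ v) (u @ v)"

definition word_class :: "'g word set \<Rightarrow> 'g word \<Rightarrow> 'g word set" where
  "word_class rels u = {v. word_eq rels u v}"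

definition presented_group :: "'g word set \<Rightarrow> 'g word set monoid" where
  "presented_group rels =
    \<lparr>carrier = range (word_class rels),
     monoid.mult = (\<lambda>X Y. {w. \<exists>u\<in>X. \<exists>v\<in>Y. word_eq rels (u @ v) w}),
     one = word_class rels []\<rparr>"

lemma word_eq_append_left: "word_eq rels u v \<Longrightarrow> word_eq rels (t @ u) (t @ v)"
proof (induction rule: word_eq.induct)
  case (cancel u g s v)
  show ?case using word_eq.cancel[of rels "t @ u" g s v] by simp
next
  case (relator r u v)
  then show ?case using word_eq.relator[of r rels "t @ u" v] by simp
qed (blast intro: word_eq.intros)+

lemma word_eq_append_right: "word_eq rels u v \<Longrightarrow> word_eq rels (u @ t) (v @ t)"
proof (induction rule: word_eq.induct)
  case (cancel u g s v)
  show ?case using word_eq.cancel[of rels u g s "v @ t"] by simp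
next
  case (relator r u v)
  then show ?case using word_eq.relator[of r rels u "v @ t"] by simp
qed (blast intro: word_eq.intros)+

lemma word_eq_append:
  "word_eq rels u u' \<Longrightarrow> word_eq rels v v' \<Longrightarrow> word_eq rels (u @ v) (u' @ v')"
  by (meson word_eq.trans word_eq_append_left word_eq_append_right)

lemma word_class_eq_iff: "word_class rels u = word_class rels v \<longleftrightarrow> word_eq rels u v"
  unfolding word_class_def by (blast intro: word_eq.intros)

lemma mult_word_class:
  "word_class rels u \<otimes>\<^bsub>presented_group rels\<^esub> word_class rels v = word_class rels (u @ v)"
  unfolding presented_group_def word_class_def
  by (auto intro: word_eq.refl word_eq.trans word_eq_append)

lemma word_inv_left: "word_eq rels (word_inv w @ w) []"
proof (induction w)
  case Nil
  show ?case by (simp add: word_inv_def word_eq.refl)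
next
  case (Cons x w)
  obtain g s where x: "x = (g, s)" by (cases x)
  have "word_eq rels (word_inv w @ [(g, \<not> s), (g, \<not> \<not> s)] @ w) (word_inv w @ w)"
    by (rule word_eq.cancel)
  then show ?case
    using Cons.IH word_eq.trans by (fastforce simp: word_inv_def x)
qed

lemma group_presented_group: "group (presented_group rels)"
proof (rule groupI)
  fix x assume "x \<in> carrier (presented_group rels)"
  then obtain w where w: "x = word_class rels w"
    by (auto simp: presented_group_def)
  have "word_class rels (word_inv w) \<otimes>\<^bsub>presented_group rels\<^esub> x = \<one>\<^bsub>presented_group rels\<^esub>"
    unfolding w mult_word_class
    by (simp add: presented_group_def word_class_eq_iff word_inv_left)
  then show "\<exists>y\<in>carrier (presented_group rels).
      y \<otimes>\<^bsub>presented_group rels\<^esub> x = \<one>\<^bsub>presented_group rels\<^esub>"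
    by (auto simp: presented_group_def)
next
  fix x y assume "x \<in> carrier (presented_group rels)" "y \<in> carrier (presented_group rels)"
  then obtain u v where "x = word_class rels u" "y = word_class rels v"
    by (auto simp: presented_group_def)
  then show "x \<otimes>\<^bsub>presented_group rels\<^esub> y \<in> carrier (presented_group rels)"
    by (simp add: mult_word_class) (simp add: presented_group_def)
next
  fix x y z
  assume "x \<in> carrier (presented_group rels)" "y \<in> carrier (presented_group rels)"
    "z \<in> carrier (presented_group rels)"
  then obtain u v w where "x = word_class rels u" "y = word_class rels v" "z = word_class rels w"
    by (auto simp: presented_group_def)
  then show "x \<otimes>\<^bsub>presented_group rels\<^esub> y \<otimes>\<^bsub>presented_group rels\<^esub> z =
      x \<otimes>\<^bsub>presented_group rels\<^esub> (y \<otimes>\<^bsub>presented_group rels\<^esub> z)"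
    by (simp add: mult_word_class)
next
  show "\<one>\<^bsub>presented_group rels\<^esub> \<in> carrier (presented_group rels)"
    by (simp add: presented_group_def)
next
  fix x assume "x \<in> carrier (presented_group rels)"
  then obtain u where u: "x = word_class rels u"
    by (auto simp: presented_group_def)
  have "\<one>\<^bsub>presented_group rels\<^esub> = word_class rels []"
    by (simp add: presented_group_def)
  then show "\<one>\<^bsub>presented_group rels\<^esub> \<otimes>\<^bsub>presented_group rels\<^esub> x = x"
    by (simp add: u mult_word_class)
qed

section \<open>Semidirect products and the group $G_5$\<close>

definition semidirect_product ::
    "('n, 'k) monoid_scheme \<Rightarrow> ('h, 'l) monoid_scheme \<Rightarrow> ('h \<Rightarrow> 'n \<Rightarrow> 'n) \<Rightarrow> ('n \<times> 'h) monoid" where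
  "semidirect_product N H \<phi> =
    \<lparr>carrier = carrier N \<times> carrier H,
     monoid.mult = (\<lambda>(n, h) (n', h'). (n \<otimes>\<^bsub>N\<^esub> \<phi> h n', h \<otimes>\<^bsub>H\<^esub> h')),
     one = (\<one>\<^bsub>N\<^esub>, \<one>\<^bsub>H\<^esub>)\<rparr>"

datatype abc = A | B | C

text \<open>The last relator encodes $[b,a] = a^p$.\<close>

definition G5_relators :: "nat \<Rightarrow> abc word set" where
  "G5_relators p =
    {word_pow (gen A) (p\<^sup>2), word_pow (gen B) p, word_pow (gen C) p,
     word_comm (gen A) (gen C), word_comm (gen B) (gen C),
     word_comm (gen B) (gen A) @ word_inv (word_pow (gen A) p)}"

definition G5 :: "nat \<Rightarrow> abc word set monoid" where
  "G5 p = presented_group (G5_relators p)"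

end

theory Submission
  imports Defs "HOL-Number_Theory.Cong"
begin

text \<open>
  The group \<open>G\<^sub>5\<close> is compared with an explicit model \<open>C\<^sub>p \<times> (C\<^bsub>p^2\<^esub> \<rtimes> C\<^sub>p)\<close> on integer triples: the
  relations bring every element into the form \<open>a\<^sup>n b\<^sup>h c\<^sup>k\<close>, and evaluating words in the model
  shows that these forms are distinct. A nearring multiplication with identity \<open>a\<close> on the model is
  a monoid of endomorphisms for which evaluation at \<open>a\<close> is a bijection onto the group.
\<close>

section \<open>Words and presented groups\<close>

text \<open>An endomorphism that sends a to x = a^n b^h c^k and b, c to b^e, c^e has to satisfy
  [b^e, x] = x^p, the image of [b, a] = a^p. Here [b, x] = a^(pn), and x^p = a^(pn) because p
  divides (p choose 2) for odd p. So e = 1 is always compatible, and e = 0 is compatible exactly if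
  p divides n. For p = 2 and x = ab this breaks down: (ab)^2 = a^4 is trivial although a^2 is not.
  Taking e = 0 whenever p divides n also yields 0 * y = 0 in the nearring.\<close>

definition word_eval :: "('x, 'm) monoid_scheme \<Rightarrow> ('g \<Rightarrow> 'x) \<Rightarrow> 'g word \<Rightarrow> 'x" where
  "word_eval K f w =
    foldr (\<lambda>(g, s) x. (if s then f g else inv\<^bsub>K\<^esub> f g) \<otimes>\<^bsub>K\<^esub> x) w \<one>\<^bsub>K\<^esub>"

lemma word_eval_Nil [simp]: "word_eval K f [] = \<one>\<^bsub>K\<^esub>"
  by (simp add: word_eval_def)

lemma word_eval_Cons [simp]:
  "word_eval K f ((g, s) # w) = (if s then f g else inv\<^bsub>K\<^esub> f g) \<otimes>\<^bsub>K\<^esub> word_eval K f w"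
  by (simp add: word_eval_def)

context group
begin

lemma word_eval_closed: "range f \<subseteq> carrier G \<Longrightarrow> word_eval G f w \<in> carrier G"
  by (induction w) (auto simp: word_eval_def image_subset_iff)

lemma word_eval_append:
  "range f \<subseteq> carrier G \<Longrightarrow> word_eval G f (u @ v) = word_eval G f u \<otimes> word_eval G f v"
proof (induction u)
  case (Cons x u)
  then have "f g \<in> carrier G" for g by auto
  with Cons show ?case
    by (cases x) (simp add: word_eval_closed m_assoc)
qed (simp add: word_eval_closed)

lemma word_eval_gen: "range f \<subseteq> carrier G \<Longrightarrow> word_eval G f (gen g) = f g"
  by (auto simp: gen_def image_subset_iff)

lemma word_eval_inv:
  assumes "range f \<subseteq> carrier G"
  shows "word_eval G f (word_inv w) = inv (word_eval G f w)"
proof (induction w)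
  case (Cons x w)
  have "f g \<in> carrier G" for g using assms by auto
  then show ?case using Cons assms
    by (cases x) (auto simp: word_inv_def word_eval_append word_eval_closed inv_mult_group)
qed (simp add: word_inv_def)

lemma word_eval_pow:
  "range f \<subseteq> carrier G \<Longrightarrow> word_eval G f (word_pow w n) = word_eval G f w [^] n"
  by (induction n)
     (simp_all add: word_pow_def word_eval_append word_eval_closed nat_pow_Suc2
        del: nat_pow_Suc Group.nat_pow_Suc)

lemmas word_eval_simps =
  word_eval_append word_eval_gen word_eval_inv word_eval_pow

text \<open>Von Dyck's theorem; it lets evaluation in the model tell classes of words apart.\<close>

lemma word_eval_respects:
  assumes "word_eq rels u v" and f: "range f \<subseteq> carrier G"
    and rels: "\<And>r. r \<in> rels \<Longrightarrow> word_eval G f r = \<one>"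
  shows "word_eval G f u = word_eval G f v"
  using assms(1)
proof induction
  case (cancel u g s v)
  have "f g \<in> carrier G" using f by auto
  then have "word_eval G f [(g, s), (g, \<not> s)] = \<one>" by simp
  then show ?case
    by (simp only: word_eval_append[OF f] l_one word_eval_closed[OF f])
next
  case (relator r u v)
  with word_eval_closed[OF f] rels show ?case by (simp add: word_eval_append[OF f])
qed auto

end

lemma word_class_closed [simp]: "word_class rels w \<in> carrier (presented_group rels)"
  by (simp add: presented_group_def)

lemma word_class_Nil: "word_class rels [] = \<one>\<^bsub>presented_group rels\<^esub>"
  by (simp add: presented_group_def)

lemma word_class_inv:
  "word_class rels (word_inv w) = inv\<^bsub>presented_group rels\<^esub> word_class rels w"
proof -
  interpret group "presented_group rels" by (rule group_presented_group)
  have "word_class rels (word_inv w) \<otimes>\<^bsub>presented_group rels\<^esub> word_class rels w =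
      \<one>\<^bsub>presented_group rels\<^esub>"
    by (simp add: mult_word_class word_inv_left word_class_eq_iff flip: word_class_Nil)
  then show ?thesis by (simp add: inv_equality)
qed

lemma word_class_pow:
  "word_class rels (word_pow w n) = word_class rels w [^]\<^bsub>presented_group rels\<^esub> n"
proof -
  interpret group "presented_group rels" by (rule group_presented_group)
  show ?thesis
    by (induction n)
       (simp_all add: word_pow_def word_class_Nil nat_pow_Suc2
        del: nat_pow_Suc Group.nat_pow_Suc flip: mult_word_class)
qed

lemma word_class_relator: "r \<in> rels \<Longrightarrow> word_class rels r = \<one>\<^bsub>presented_group rels\<^esub>"
  using word_eq.relator[of r rels "[]" "[]"] by (simp add: word_class_eq_iff flip: word_class_Nil)

text \<open>The image of a homomorphism is a subgroup, so this reduces surjectivity onto a presented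
  group to the generators.\<close>

lemma presented_group_generated:
  assumes H: "subgroup H (presented_group rels)" and gens: "\<And>g. word_class rels (gen g) \<in> H"
  shows "H = carrier (presented_group rels)"
proof -
  have "word_class rels w \<in> H" for w
  proof (induction w)
    case Nil
    show ?case using subgroup.one_closed[OF H] by (simp add: word_class_Nil)
  next
    case (Cons x w)
    obtain g s where x: "x = (g, s)" by (cases x)
    have "[x] = (if s then gen g else word_inv (gen g))"
      by (simp add: x gen_def word_inv_def)
    then have "word_class rels [x] \<in> H"
      using gens subgroup.m_inv_closed[OF H] by (simp add: word_class_inv)
    then show ?case
      using subgroup.m_closed[OF H _ Cons.IH] by (fastforce simp: mult_word_class)
  qed
  then show ?thesis
    using subgroup.subset[OF H] by (auto simp: presented_group_def)
qed

section \<open>Semidirect products\<close>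

lemma group_semidirect_product:
  assumes N: "group N" and H: "group H" and \<phi>: "\<phi> \<in> hom H (AutoGroup N)"
  shows "group (semidirect_product N H \<phi>)"
proof -
  interpret N: group N by fact
  interpret H: group H by fact
  interpret A: group "AutoGroup N" by (rule N.AutoGroup)
  interpret \<phi>: group_hom H "AutoGroup N" \<phi>
    using \<phi> by unfold_locales
  have auto: "\<phi> h \<in> hom N N" "\<phi> h \<in> Bij (carrier N)" if "h \<in> carrier H" for h
    using \<phi>.hom_closed[OF that] by (auto simp: AutoGroup_def auto_def)
  have closed: "\<phi> h n \<in> carrier N" if "h \<in> carrier H" "n \<in> carrier N" for h n
    using auto(1)[OF that(1)] that(2) by (rule hom_in_carrier)
  have mult: "\<phi> h (n \<otimes>\<^bsub>N\<^esub> m) = \<phi> h n \<otimes>\<^bsub>N\<^esub> \<phi> h m"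
    if "h \<in> carrier H" "n \<in> carrier N" "m \<in> carrier N" for h n m
    using hom_mult[OF auto(1)] that by blast
  have comp: "\<phi> (g \<otimes>\<^bsub>H\<^esub> h) n = \<phi> g (\<phi> h n)"
    if "g \<in> carrier H" "h \<in> carrier H" "n \<in> carrier N" for g h n
    using that auto by (simp add: \<phi>.hom_mult) (simp add: AutoGroup_def BijGroup_def compose_eq)
  have one: "\<phi> \<one>\<^bsub>H\<^esub> n = n" if "n \<in> carrier N" for n
    using that by (simp add: \<phi>.hom_one) (simp add: AutoGroup_def BijGroup_def)
  show ?thesis
  proof (rule groupI)
    fix x assume "x \<in> carrier (semidirect_product N H \<phi>)"
    then obtain n h where x: "x = (n, h)" "n \<in> carrier N" "h \<in> carrier H"
      by (auto simp: semidirect_product_def)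
    \<comment> \<open>Left multiplication by an element over \<open>?g\<close> applies
      \<open>\<phi> ?g\<close> to n, which dictates the first coordinate of the inverse. Rewriting
      with \<open>\<phi>.hom_inv\<close> would hide that value behind an inverse in
      \<open>AutoGroup N\<close>.\<close>
    let ?g = "inv\<^bsub>H\<^esub> h"
    have "(inv\<^bsub>N\<^esub> \<phi> ?g n, ?g) \<otimes>\<^bsub>semidirect_product N H \<phi>\<^esub> x = \<one>\<^bsub>semidirect_product N H \<phi>\<^esub>"
      using x by (simp add: semidirect_product_def closed del: \<phi>.hom_inv)
    then show "\<exists>y\<in>carrier (semidirect_product N H \<phi>).
        y \<otimes>\<^bsub>semidirect_product N H \<phi>\<^esub> x = \<one>\<^bsub>semidirect_product N H \<phi>\<^esub>"
      by (rule bexI) (use x in \<open>auto simp: semidirect_product_def closed simp del: \<phi>.hom_inv\<close>)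
  qed (auto simp: semidirect_product_def closed mult comp one N.m_assoc H.m_assoc
      simp del: \<phi>.hom_mult \<phi>.hom_one)
qed

section \<open>The concrete model of $G_5$\<close>

text \<open>Conjugation by b^h on the powers of a: (1 + p)^h is 1 + p h modulo p^2. The restriction
  to the carrier makes the map extensional, as members of \<open>Bij\<close> must be.\<close>

definition twist :: "nat \<Rightarrow> int \<Rightarrow> int \<Rightarrow> int" where
  "twist p h = (\<lambda>n\<in>carrier (integer_mod_group (p\<^sup>2)). ((1 + int p * h) * n) mod (int p)\<^sup>2)"

text \<open>The triple (k, n, h) stands for a^n b^h c^k.\<close>

definition model :: "nat \<Rightarrow> (int \<times> int \<times> int) monoid" where
  "model p = integer_mod_group p \<times>\<times>
     semidirect_product (integer_mod_group (p\<^sup>2)) (integer_mod_group p) (twist p)"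

lemma twist_factor_mod:
  "(1 + p * (h mod p)) * n mod p\<^sup>2 = (1 + p * h) * n mod p\<^sup>2" for p h n :: int
proof -
  have "(1 + p * (p * q + r)) * n = (1 + p * r) * n + p\<^sup>2 * (q * n)" for q r
    by (simp add: algebra_simps power2_eq_square)
  from this[of "h div p" "h mod p"]
  have "(1 + p * h) * n = (1 + p * (h mod p)) * n + p\<^sup>2 * (h div p * n)" by simp
  then show ?thesis by simp
qed

text \<open>In (1 + p g)(1 + p h) the cross term p^2 g h vanishes modulo p^2.\<close>

lemma twist_comp:
  assumes "n \<in> carrier (integer_mod_group (p\<^sup>2))" "p > 0"
  shows "twist p ((g + h) mod int p) n = twist p g (twist p h n)"
proof -
  let ?P = "int p" and ?Q = "(int p)\<^sup>2"
  have "twist p ((g + h) mod ?P) n = (1 + ?P * (g + h)) * n mod ?Q"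
    using assms by (simp add: twist_def twist_factor_mod)
  also have "\<dots> = ((1 + ?P * g) * ((1 + ?P * h) * n)) mod ?Q"
  proof -
    have "(1 + ?P * g) * ((1 + ?P * h) * n) = (1 + ?P * (g + h)) * n + ?Q * (g * h * n)"
      by (simp add: algebra_simps power2_eq_square)
    then show ?thesis by simp
  qed
  also have "\<dots> = twist p g (twist p h n)"
    using assms by (simp add: twist_def carrier_integer_mod_group mod_mult_right_eq)
  finally show ?thesis .
qed

lemma twist_hom:
  assumes "p > 0"
  shows "twist p \<in> hom (integer_mod_group p) (AutoGroup (integer_mod_group (p\<^sup>2)))"
proof -
  let ?N = "integer_mod_group (p\<^sup>2)" and ?S = "carrier (integer_mod_group (p\<^sup>2))"
  have S: "?S = {0..<(int p)\<^sup>2}" using assms by (simp add: carrier_integer_mod_group)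
  have closed: "twist p h n \<in> ?S" if "n \<in> ?S" for h n
    using that assms unfolding twist_def by (simp add: S)
  have zero: "twist p 0 n = n" if "n \<in> ?S" for n
    using that unfolding twist_def by (simp add: S)
  have "bij_betw (twist p h) ?S ?S" for h
  \<comment> \<open>The unreduced \<open>- h\<close> can serve here, as \<open>twist_comp\<close>
    reduces only the sum of the exponents.\<close>
  proof (rule bij_betw_byWitness[where f' = "twist p (- h)"])
    show "\<forall>n\<in>?S. twist p (- h) (twist p h n) = n" "\<forall>n\<in>?S. twist p h (twist p (- h) n) = n"
      using assms zero by (simp_all flip: twist_comp)
  qed (use closed in auto)
  then have Bij: "twist p h \<in> Bij ?S" for h
    by (simp add: Bij_def twist_def)
  have "twist p h \<in> hom ?N ?N" for h
    using assms by (intro homI closed) (simp_all add: twist_def S distrib_left mod_simps)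
  with Bij have "twist p h \<in> auto ?N" for h by (simp add: auto_def)
  moreover have "twist p ((g + h) mod int p) = compose ?S (twist p g) (twist p h)" for g h
  proof (rule extensionalityI[of _ ?S])
    show "twist p ((g + h) mod int p) \<in> extensional ?S" by (simp add: twist_def)
  qed (simp_all add: assms twist_comp compose_eq)
  ultimately show ?thesis
    using Bij by (intro homI) (simp_all add: AutoGroup_def BijGroup_def)
qed

lemma group_model: "p > 0 \<Longrightarrow> group (model p)"
  unfolding model_def
  by (intro DirProd_group group_semidirect_product twist_hom group_integer_mod_group)

lemma carrier_model:
  "p > 0 \<Longrightarrow> carrier (model p) = {0..<int p} \<times> {0..<(int p)\<^sup>2} \<times> {0..<int p}"
  by (simp add: model_def semidirect_product_def carrier_integer_mod_group)

text \<open>The hypothesis on m keeps the argument of \<open>twist\<close> inside the carrier;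
  elsewhere the restricted function is \<open>undefined\<close>.\<close>

lemma mult_model:
  assumes "p > 0" "m \<in> {0..<(int p)\<^sup>2}"
  shows "(k, n, h) \<otimes>\<^bsub>model p\<^esub> (k', m, h') =
    ((k + k') mod int p, (n + (1 + int p * h) * m) mod (int p)\<^sup>2, (h + h') mod int p)"
  using assms
  by (simp add: model_def semidirect_product_def twist_def carrier_integer_mod_group mod_simps)

lemma one_model: "\<one>\<^bsub>model p\<^esub> = (0, 0, 0)"
  by (simp add: model_def semidirect_product_def)

lemma card_model: "p > 0 \<Longrightarrow> order (model p) = p ^ 4"
  by (simp add: order_def carrier_model card_cartesian_product nat_mult_distrib
      power2_eq_square power4_eq_xxxx)

lemma pow_model:
  assumes "p > 1"
  shows "(0, 1, 0) [^]\<^bsub>model p\<^esub> (i :: nat) = (0, int i mod (int p)\<^sup>2, 0)"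
    and "(0, 0, 1) [^]\<^bsub>model p\<^esub> (i :: nat) = (0, 0, int i mod int p)"
    and "(1, 0, 0) [^]\<^bsub>model p\<^esub> (i :: nat) = (int i mod int p, 0, 0)"
proof -
  have "(int p)\<^sup>2 > 1" using assms by (simp add: one_less_power)
  then show "(0, 1, 0) [^]\<^bsub>model p\<^esub> i = (0, int i mod (int p)\<^sup>2, 0)"
    using assms
    by (induction i) (simp_all add: one_model mult_model mod_add_left_eq add.commute[of 1])
  show "(0, 0, 1) [^]\<^bsub>model p\<^esub> i = (0, 0, int i mod int p)"
    "(1, 0, 0) [^]\<^bsub>model p\<^esub> i = (int i mod int p, 0, 0)"
    using assms
    by (induction i) (simp_all add: one_model mult_model mod_add_left_eq add.commute[of 1])
qed

section \<open>Commutators and powers in an arbitrary group\<close>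

context group
begin

lemma commutator_eq_iff:
  assumes "u \<in> carrier G" "v \<in> carrier G" "w \<in> carrier G"
  shows "inv u \<otimes> (inv v \<otimes> (u \<otimes> v)) = w \<longleftrightarrow> u \<otimes> v = v \<otimes> u \<otimes> w"
proof -
  have "inv u \<otimes> (inv v \<otimes> (u \<otimes> v)) = inv (v \<otimes> u) \<otimes> (u \<otimes> v)"
    using assms by (simp add: inv_mult_group m_assoc)
  then show ?thesis
    using assms by (metis inv_solve_left' m_closed)
qed

text \<open>x is conjugate to y by g, and conjugation respects powers. The form without inverses
  also fits commuting elements, where x = y.\<close>

lemma pow_intertwine:
  assumes "x \<otimes> g = g \<otimes> y" and [simp]: "x \<in> carrier G" "y \<in> carrier G" "g \<in> carrier G"
  shows "x [^] (n :: nat) \<otimes> g = g \<otimes> y [^] n"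
proof (induction n)
  case (Suc n)
  have "x [^] Suc n \<otimes> g = x [^] n \<otimes> (g \<otimes> y)" by (simp add: m_assoc assms(1))
  also have "\<dots> = g \<otimes> y [^] Suc n" by (simp add: Suc.IH m_assoc flip: m_assoc[of "x [^] n"])
  finally show ?case .
qed simp

lemma pow_add_multiple:
  assumes "x \<in> carrier G" "x [^] d = \<one>"
  shows "x [^] (i + d * j :: nat) = x [^] i"
  using assms by (simp flip: nat_pow_mult nat_pow_pow)

lemma pow_mod_exponent:
  assumes "x \<in> carrier G" "x [^] d = \<one>"
  shows "x [^] (i mod d :: nat) = x [^] i"
  using pow_add_multiple[OF assms, of "i mod d" "i div d"] by simp

text \<open>
  The hypothesis says \<open>b\<^sup>-\<^sup>1 a b = a\<^sup>1\<^sup>-\<^sup>p\<close>. It is inverted by raising to the power \<open>1 + p\<close>,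
  as \<open>(1 + p) (1 - p) \<equiv> 1\<close> modulo \<open>p\<^sup>2\<close>.
\<close>

lemma power_commutation:
  assumes [simp]: "a \<in> carrier G" "b \<in> carrier G"
    and a_pow: "a [^] p\<^sup>2 = \<one>" and ba: "b \<otimes> a = a \<otimes> b \<otimes> a [^] (p :: nat)"
  shows "b \<otimes> a = a [^] (1 + p) \<otimes> b"
proof -
  \<comment> \<open>The exponent 1 - p as a natural number modulo p^2; the product (1 - p + p^2)(1 +
    p) is 1 + p^3.\<close>
  define e where "e = 1 + (p\<^sup>2 - p)"
  have le: "p \<le> p\<^sup>2" by (simp add: power2_eq_square)
  have "a \<otimes> b = a \<otimes> b \<otimes> a [^] (p + (p\<^sup>2 - p))"
    using le by (simp add: a_pow)
  also have "\<dots> = b \<otimes> (a \<otimes> a [^] (p\<^sup>2 - p))"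
    by (simp add: m_assoc ba flip: nat_pow_mult) (simp add: ba flip: m_assoc)
  also have "a \<otimes> a [^] (p\<^sup>2 - p) = a [^] e"
    using nat_pow_mult[of a 1 "p\<^sup>2 - p"] by (simp add: e_def)
  finally have "a [^] (1 + p) \<otimes> b = b \<otimes> (a [^] e) [^] (1 + p)"
    by (intro pow_intertwine) auto
  also have "(a [^] e) [^] (1 + p) = a [^] (e * (1 + p))"
    by (simp only: nat_pow_pow assms)
  also have "e * (1 + p) = 1 + p\<^sup>2 * p"
  proof -
    have "int (e * (1 + p)) = int (1 + p\<^sup>2 * p)"
      using le by (simp add: e_def of_nat_diff algebra_simps power2_eq_square)
    then show ?thesis by (simp only: of_nat_eq_iff)
  qed
  also have "a [^] (1 + p\<^sup>2 * p) = a"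
    using pow_add_multiple[OF assms(1) a_pow, of 1 p] by simp
  finally show ?thesis by simp
qed

end

section \<open>Normal forms from the relations\<close>

text \<open>The group is arbitrary, so the relations may hold in a collapsed form. In
  \<open>ba\<close> the commutator relation already moves b to the right of a, which keeps all
  exponents natural numbers.\<close>

locale G5_generators = group +
  fixes p :: nat and a b c
  assumes p_pos: "p > 0"
    and closed [simp]: "a \<in> carrier G" "b \<in> carrier G" "c \<in> carrier G"
    and a_pow: "a [^] p\<^sup>2 = \<one>" and b_pow: "b [^] p = \<one>" and c_pow: "c [^] p = \<one>"
    and ac: "a \<otimes> c = c \<otimes> a" and bc: "b \<otimes> c = c \<otimes> b"
    and ba: "b \<otimes> a = a [^] (1 + p) \<otimes> b"
begin

definition normal_form :: "int \<times> int \<times> int \<Rightarrow> 'a" where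
  "normal_form = (\<lambda>(k, n, h). a [^] nat n \<otimes> b [^] nat h \<otimes> c [^] nat k)"

lemma c_pow_swap:
  "c [^] (k :: nat) \<otimes> a [^] (m :: nat) = a [^] m \<otimes> c [^] k"
  "c [^] (k :: nat) \<otimes> b [^] (m :: nat) = b [^] m \<otimes> c [^] k"
proof -
  have "a [^] m \<otimes> c = c \<otimes> a [^] m" "b [^] m \<otimes> c = c \<otimes> b [^] m"
    using ac bc by (auto intro: pow_intertwine)
  then show "c [^] (k :: nat) \<otimes> a [^] (m :: nat) = a [^] m \<otimes> c [^] k"
    "c [^] (k :: nat) \<otimes> b [^] (m :: nat) = b [^] m \<otimes> c [^] k"
    by (auto intro!: pow_intertwine)
qed

text \<open>Conjugation by b^h raises a to the power (1 + p)^h, which agrees with 1 + p h modulo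
  p^2; the surplus in each step is a multiple of p^2 and is killed by \<open>a_pow\<close>.\<close>

lemma b_pow_a_pow: "b [^] (h :: nat) \<otimes> a [^] (m :: nat) = a [^] ((1 + p * h) * m) \<otimes> b [^] h"
proof (induction h)
  case (Suc h)
  have b_a_pow: "b \<otimes> a [^] i = a [^] ((1 + p) * i) \<otimes> b" for i :: nat
  proof -
    have "(a [^] (1 + p)) [^] i \<otimes> b = b \<otimes> a [^] i"
      by (rule pow_intertwine[OF ba[symmetric]]) auto
    then show ?thesis by (simp only: nat_pow_pow closed)
  qed
  have "b [^] Suc h \<otimes> a [^] m = b \<otimes> (b [^] h \<otimes> a [^] m)"
    by (simp add: nat_pow_Suc2 m_assoc del: nat_pow_Suc Group.nat_pow_Suc)
  also have "\<dots> = (b \<otimes> a [^] ((1 + p * h) * m)) \<otimes> b [^] h"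
    unfolding Suc.IH by (simp add: m_assoc)
  also have "\<dots> = a [^] ((1 + p) * ((1 + p * h) * m)) \<otimes> b [^] Suc h"
    unfolding b_a_pow by (simp add: nat_pow_Suc2 m_assoc del: nat_pow_Suc Group.nat_pow_Suc)
  also have "(1 + p) * ((1 + p * h) * m) = (1 + p * Suc h) * m + p\<^sup>2 * (h * m)"
    by (simp add: algebra_simps power2_eq_square)
  finally show ?case
    by (simp only: pow_add_multiple[OF closed(1) a_pow])
qed simp

text \<open>Collection read backwards: the exponent (1 + p h) m in the product of triples is what
  a^m acquires when b^h passes it, and c commutes with a and b.\<close>

lemma normal_form_hom: "normal_form \<in> hom (model p) G"
proof (rule homI)
  fix x y assume "x \<in> carrier (model p)" "y \<in> carrier (model p)"
  moreover obtain k n h k' m h' where xy: "x = (k, n, h)" "y = (k', m, h')"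
    by (metis prod.exhaust)
  ultimately have nonneg: "0 \<le> k" "0 \<le> n" "0 \<le> h" "0 \<le> k'" "0 \<le> m" "0 \<le> h'"
    and m: "m \<in> {0..<(int p)\<^sup>2}"
    by (auto simp: carrier_model p_pos)
  have "nat ((1 + int p * h) * m) = (1 + p * nat h) * nat m"
    using nonneg by (simp add: nat_mult_distrib nat_add_distrib)
  then have "normal_form (x \<otimes>\<^bsub>model p\<^esub> y) =
      a [^] ((nat n + (1 + p * nat h) * nat m) mod p\<^sup>2) \<otimes> b [^] ((nat h + nat h') mod p) \<otimes>
      c [^] ((nat k + nat k') mod p)"
    using nonneg unfolding xy mult_model[OF p_pos m]
    by (simp add: normal_form_def nat_mod_distrib nat_add_distrib nat_power_eq)
  also have "\<dots> = a [^] nat n \<otimes> a [^] ((1 + p * nat h) * nat m) \<otimes> (b [^] nat h \<otimes> b [^] nat h') \<otimes>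
      (c [^] nat k \<otimes> c [^] nat k')"
    by (simp only: pow_mod_exponent a_pow b_pow c_pow closed nat_pow_mult)
  also have "\<dots> = a [^] nat n \<otimes> (a [^] ((1 + p * nat h) * nat m) \<otimes> b [^] nat h) \<otimes>
      (b [^] nat h' \<otimes> c [^] nat k) \<otimes> c [^] nat k'"
    by (simp add: m_assoc)
  also have "\<dots> = a [^] nat n \<otimes> b [^] nat h \<otimes> (a [^] nat m \<otimes> c [^] nat k) \<otimes>
      b [^] nat h' \<otimes> c [^] nat k'"
    unfolding b_pow_a_pow[symmetric] c_pow_swap(2)[symmetric] by (simp add: m_assoc)
  also have "\<dots> = normal_form x \<otimes> normal_form y"
    unfolding c_pow_swap(1)[symmetric] by (simp add: xy normal_form_def m_assoc)
  finally show "normal_form (x \<otimes>\<^bsub>model p\<^esub> y) = normal_form x \<otimes> normal_form y" .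
qed (auto simp: normal_form_def)

end

section \<open>Isomorphism of the model with the presented group\<close>

fun model_gen :: "abc \<Rightarrow> int \<times> int \<times> int" where
  "model_gen A = (0, 1, 0)" | "model_gen B = (0, 0, 1)" | "model_gen C = (1, 0, 0)"

lemma model_gen_closed:
  assumes "p > 1"
  shows "range model_gen \<subseteq> carrier (model p)"
proof (rule image_subsetI)
  fix g
  have "(int p)\<^sup>2 > 1" using assms by (simp add: one_less_power)
  with assms show "model_gen g \<in> carrier (model p)"
    by (cases g) (simp_all add: carrier_model)
qed

lemma word_eval_relators:
  assumes "p > 1" "r \<in> G5_relators p"
  shows "word_eval (model p) model_gen r = \<one>\<^bsub>model p\<^esub>"
proof -
  interpret K: group "model p" using assms by (simp add: group_model)
  have Q: "(int p)\<^sup>2 > 1" using assms by (simp add: one_less_power)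
  have f: "range model_gen \<subseteq> carrier (model p)" by (rule model_gen_closed[OF assms(1)])
  then have [simp]: "model_gen g \<in> carrier (model p)" for g by auto
  have "int p mod (int p)\<^sup>2 = int p" using assms by (simp add: power2_eq_square)
  then have pow: "model_gen A [^]\<^bsub>model p\<^esub> p = (0, int p, 0)"
    "model_gen A [^]\<^bsub>model p\<^esub> p\<^sup>2 = \<one>\<^bsub>model p\<^esub>"
    "model_gen B [^]\<^bsub>model p\<^esub> p = \<one>\<^bsub>model p\<^esub>" "model_gen C [^]\<^bsub>model p\<^esub> p = \<one>\<^bsub>model p\<^esub>"
    using pow_model[OF assms(1)] by (simp_all add: one_model)
  have pQ: "int p \<in> {0..<(int p)\<^sup>2}" using assms by (simp add: power2_eq_square)
  \<comment> \<open>The a-coordinate of a b a^p is 1 + (1 + p) p, that of b a is 1 + p.\<close>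
  have "(1 + (int p + int p * int p)) mod (int p * int p) = (1 + int p) mod (int p * int p)"
    by (metis add.assoc mod_add_self2)
  then have "model_gen B \<otimes>\<^bsub>model p\<^esub> model_gen A =
      model_gen A \<otimes>\<^bsub>model p\<^esub> model_gen B \<otimes>\<^bsub>model p\<^esub> (model_gen A [^]\<^bsub>model p\<^esub> p)"
    "model_gen A \<otimes>\<^bsub>model p\<^esub> model_gen C = model_gen C \<otimes>\<^bsub>model p\<^esub> model_gen A"
    "model_gen B \<otimes>\<^bsub>model p\<^esub> model_gen C = model_gen C \<otimes>\<^bsub>model p\<^esub> model_gen B"
    using assms(1) Q pQ unfolding pow(1) by (simp_all add: mult_model distrib_right power2_eq_square)
  moreover have "word_eval (model p) model_gen (word_comm (gen u) (gen v)) = w"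
    if "model_gen u \<otimes>\<^bsub>model p\<^esub> model_gen v = model_gen v \<otimes>\<^bsub>model p\<^esub> model_gen u \<otimes>\<^bsub>model p\<^esub> w"
      "w \<in> carrier (model p)" for u v w
    using that K.commutator_eq_iff[of "model_gen u" "model_gen v" w]
    by (simp only: word_comm_def K.word_eval_simps[OF f]) simp
  ultimately have "word_eval (model p) model_gen (word_comm (gen A) (gen C)) = \<one>\<^bsub>model p\<^esub>"
    "word_eval (model p) model_gen (word_comm (gen B) (gen C)) = \<one>\<^bsub>model p\<^esub>"
    "word_eval (model p) model_gen (word_comm (gen B) (gen A)) = model_gen A [^]\<^bsub>model p\<^esub> p"
    by (simp_all del: model_gen.simps)
  then show ?thesis
    using assms(2) pow(2-4) unfolding G5_relators_def
    by (auto simp: K.word_eval_simps[OF f] simp del: model_gen.simps)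
qed

text \<open>Evaluation recovers the exponents, which makes the normal form map injective.\<close>

lemma word_eval_normal_form:
  assumes "p > 1" "(k, n, h) \<in> carrier (model p)"
  shows "word_eval (model p) model_gen
    (word_pow (gen A) (nat n) @ word_pow (gen B) (nat h) @ word_pow (gen C) (nat k)) = (k, n, h)"
proof -
  interpret K: group "model p" using assms by (simp add: group_model)
  note f = model_gen_closed[OF assms(1)]
  show ?thesis
    using assms by (simp add: K.word_eval_simps[OF f] pow_model carrier_model mult_model del: pow_nat)
qed

lemma model_iso_G5:
  assumes "p > 1"
  shows "model p \<cong> G5 p"
proof -
  interpret K: group "model p" using assms by (simp add: group_model)
  interpret G: group "G5 p" unfolding G5_def by (rule group_presented_group)
  let ?cl = "word_class (G5_relators p)"
  have cl [simp]: "?cl w \<in> carrier (G5 p)" for w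
    by (simp add: G5_def)
  have cl_append: "?cl (u @ v) = ?cl u \<otimes>\<^bsub>G5 p\<^esub> ?cl v" for u v
    by (simp add: G5_def mult_word_class)
  have cl_inv: "?cl (word_inv w) = inv\<^bsub>G5 p\<^esub> ?cl w" for w
    by (simp add: G5_def word_class_inv)
  have cl_pow: "?cl (word_pow w n) = ?cl w [^]\<^bsub>G5 p\<^esub> n" for w n
    by (simp add: G5_def word_class_pow)
  have rel: "?cl r = \<one>\<^bsub>G5 p\<^esub>" if "r \<in> G5_relators p" for r
    using that by (simp add: G5_def word_class_relator)
  have mem: "word_pow (gen A) (p\<^sup>2) \<in> G5_relators p" "word_pow (gen B) p \<in> G5_relators p"
    "word_pow (gen C) p \<in> G5_relators p" "word_comm (gen A) (gen C) \<in> G5_relators p"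
    "word_comm (gen B) (gen C) \<in> G5_relators p"
    "word_comm (gen B) (gen A) @ word_inv (word_pow (gen A) p) \<in> G5_relators p"
    by (simp_all add: G5_relators_def)
  let ?a = "?cl (gen A)" and ?b = "?cl (gen B)" and ?c = "?cl (gen C)"
  have comm: "?cl u \<otimes>\<^bsub>G5 p\<^esub> ?cl v = ?cl v \<otimes>\<^bsub>G5 p\<^esub> ?cl u"
    if "word_comm u v \<in> G5_relators p" for u v
    using rel[OF that] G.commutator_eq_iff[of "?cl u" "?cl v" "\<one>\<^bsub>G5 p\<^esub>"]
    by (simp add: word_comm_def cl_append cl_inv)
  have a_pow: "?a [^]\<^bsub>G5 p\<^esub> p\<^sup>2 = \<one>\<^bsub>G5 p\<^esub>"
    using rel[OF mem(1)] by (simp add: cl_pow)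
  have "?cl (word_comm (gen B) (gen A)) = ?a [^]\<^bsub>G5 p\<^esub> p"
    using rel[OF mem(6)] G.inv_solve_right'
      [of "\<one>\<^bsub>G5 p\<^esub>" "?cl (word_comm (gen B) (gen A))" "?a [^]\<^bsub>G5 p\<^esub> p"]
    by (simp add: cl_append[of "word_comm _ _"] cl_inv cl_pow)
  then have aba: "?b \<otimes>\<^bsub>G5 p\<^esub> ?a = ?a \<otimes>\<^bsub>G5 p\<^esub> ?b \<otimes>\<^bsub>G5 p\<^esub> ?a [^]\<^bsub>G5 p\<^esub> p"
    by (simp add: word_comm_def cl_append cl_inv G.commutator_eq_iff)
  have ba: "?b \<otimes>\<^bsub>G5 p\<^esub> ?a = ?a [^]\<^bsub>G5 p\<^esub> (1 + p) \<otimes>\<^bsub>G5 p\<^esub> ?b"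
    by (rule G.power_commutation[OF _ _ a_pow aba]) simp_all
  interpret N: G5_generators "G5 p" p ?a ?b ?c
    using assms a_pow ba rel[OF mem(2)] rel[OF mem(3)] comm[OF mem(4)] comm[OF mem(5)]
    by unfold_locales (simp_all only: cl cl_pow)
  interpret N: group_hom "model p" "G5 p" N.normal_form
    using N.normal_form_hom by unfold_locales
  have word: "N.normal_form (k, n, h) =
      ?cl (word_pow (gen A) (nat n) @ word_pow (gen B) (nat h) @ word_pow (gen C) (nat k))" for k n h
    by (simp add: N.normal_form_def cl_append cl_pow G.m_assoc)
  have "inj_on N.normal_form (carrier (model p))"
  proof (rule inj_onI)
    fix x y assume x: "x \<in> carrier (model p)" and y: "y \<in> carrier (model p)"
      and eq: "N.normal_form x = N.normal_form y"
    obtain k n h k' m h' where xy: "x = (k, n, h)" "y = (k', m, h')"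
      by (metis prod.exhaust)
    note resp = K.word_eval_respects[OF _ model_gen_closed[OF assms] word_eval_relators[OF assms]]
    show "x = y"
      using resp[OF eq[unfolded xy word word_class_eq_iff]] x y
      unfolding xy by (simp only: word_eval_normal_form[OF assms])
  qed
  moreover have "?cl (gen g) \<in> N.normal_form ` carrier (model p)" for g
  proof -
    have "N.normal_form (model_gen g) = ?cl (gen g)"
      by (cases g) (simp_all add: N.normal_form_def)
    then show ?thesis
      using model_gen_closed[OF assms] by (metis image_eqI range_subsetD)
  qed
  then have "N.normal_form ` carrier (model p) = carrier (G5 p)"
    using presented_group_generated[of _ "G5_relators p"] N.img_is_subgroup
    by (simp add: G5_def)
  ultimately have "N.normal_form \<in> iso (model p) (G5 p)"
    using N.normal_form_hom by (simp add: iso_def bij_betw_def)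
  then show ?thesis by (rule is_isoI)
qed

section \<open>The local nearring\<close>

text \<open>
  Writing a multiplication as \<open>x \<cdot> y = \<lambda>\<^sub>x y\<close>, left distributivity says that every
  \<open>\<lambda>\<^sub>x\<close> is an endomorphism, and associativity that \<open>\<lambda>\<^sub>x \<circ> \<lambda>\<^sub>y\<close> is \<open>\<lambda>\<close> at \<open>\<lambda>\<^sub>x y\<close>. For
  \<open>x = a\<^sup>n b\<^sup>h c\<^sup>k\<close> let \<open>\<lambda>\<^sub>x\<close> send \<open>a\<close> to \<open>x\<close>, and either fix \<open>b\<close> and \<open>c\<close> (if \<open>p\<close> does not divide
  \<open>n\<close>) or send them to the neutral element (if \<open>p\<close> divides \<open>n\<close>). The elements of the second kind
  form a subgroup \<open>L\<close>. Associativity holds because \<open>x \<cdot> y\<close> lies in \<open>L\<close> exactly if \<open>x\<close> or \<open>y\<close>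
  does, and \<open>x\<close> is invertible exactly if it lies outside \<open>L\<close>.
\<close>

definition residue_indicator :: "nat \<Rightarrow> int \<Rightarrow> int" where
  "residue_indicator p n = (if int p dvd n then 0 else 1)"

text \<open>
  In the model \<open>(a\<^sup>n b\<^sup>h)\<^sup>m\<close> has \<open>a\<close>-coordinate \<open>n m + p n h (m choose 2)\<close>. The factor
  \<open>(p\<^sup>2 + 1) / 2\<close> is the inverse of 2 modulo \<open>p\<^sup>2\<close>.
\<close>

definition pow_coord :: "nat \<Rightarrow> int \<Rightarrow> int \<Rightarrow> int \<Rightarrow> int" where
  "pow_coord p n h m =
    n * m + int p * (((int p)\<^sup>2 + 1) div 2) * n * h * m * (m - 1)"

text \<open>The value x^m b^(e h') c^(e k') at a^m b^h' c^k', where x = a^n b^h c^k and e is the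
  indicator of n; the power x^m contributes \<open>pow_coord\<close>, h m and k m.\<close>

definition nearring_mult :: "nat \<Rightarrow> int \<times> int \<times> int \<Rightarrow> int \<times> int \<times> int \<Rightarrow> int \<times> int \<times> int" where
  "nearring_mult p = (\<lambda>(k, n, h) (k', m, h').
    ((k * m + residue_indicator p n * k') mod int p,
     pow_coord p n h m mod (int p)\<^sup>2,
     (h * m + residue_indicator p n * h') mod int p))"

definition G5_nearring :: "nat \<Rightarrow> (int \<times> int \<times> int) ring" where
  "G5_nearring p =
    \<lparr>carrier = carrier (model p), monoid.mult = nearring_mult p, one = (0, 1, 0),
     zero = \<one>\<^bsub>model p\<^esub>, add = (\<otimes>\<^bsub>model p\<^esub>)\<rparr>"

lemma add_monoid_G5_nearring: "add_monoid (G5_nearring p) = model p"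
  by (simp add: G5_nearring_def)

section \<open>Congruences for the coordinates of products\<close>

lemma cong_mod_square: "[x mod p\<^sup>2 = x] (mod p)" for x p :: int
  by (simp add: cong_def mod_mod_cancel)

text \<open>\<open>pow_coord\<close> is a polynomial with integer coefficients, since a constant
  factor replaces the halving of m (m - 1). As h occurs only in the product p h, its residue modulo
  p suffices.\<close>

lemma pow_coord_cong:
  assumes n: "[n = n'] (mod (int p)\<^sup>2)" and h: "[h = h'] (mod int p)"
    and m: "[m = m'] (mod (int p)\<^sup>2)"
  shows "[pow_coord p n h m = pow_coord p n' h' m'] (mod (int p)\<^sup>2)"
proof -
  have ph: "[int p * h = int p * h'] (mod (int p)\<^sup>2)"
    using h by (simp add: cong_iff_dvd_diff power2_eq_square mult_dvd_mono flip: right_diff_distrib)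
  have rest: "[(((int p)\<^sup>2 + 1) div 2) * n * m * (m - 1) =
      (((int p)\<^sup>2 + 1) div 2) * n' * m' * (m' - 1)] (mod (int p)\<^sup>2)"
    by (intro cong_mult cong_diff cong_refl n m)
  have "pow_coord p n h m =
      n * m + (int p * h) * ((((int p)\<^sup>2 + 1) div 2) * n * m * (m - 1))" for n h m
    by (simp add: pow_coord_def mult_ac)
  then show ?thesis
    using cong_add[OF cong_mult[OF n m] cong_mult[OF ph rest]] by (simp only:)
qed

text \<open>The indicator and the b- and c-coordinates of a product see the a-coordinates only
  modulo p, where these simply multiply.\<close>

lemma pow_coord_cong_mult: "[pow_coord p n h m mod (int p)\<^sup>2 = n * m] (mod int p)"
proof -
  have "[pow_coord p n h m = n * m] (mod int p)"
    by (simp add: pow_coord_def cong_iff_dvd_diff)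
  then show ?thesis using cong_mod_square cong_trans by blast
qed

lemma residue_indicator_mult:
  "prime p \<Longrightarrow> residue_indicator p (n * m) = residue_indicator p n * residue_indicator p m"
  by (simp add: residue_indicator_def prime_dvd_mult_iff)

lemma residue_indicator_cong:
  "[n = m] (mod int p) \<Longrightarrow> residue_indicator p n = residue_indicator p m"
  by (simp add: residue_indicator_def cong_dvd_iff)

lemma residue_indicator_pow_coord:
  "prime p \<Longrightarrow> residue_indicator p (pow_coord p n h m mod (int p)\<^sup>2) =
    residue_indicator p n * residue_indicator p m"
  using residue_indicator_cong[OF pow_coord_cong_mult] residue_indicator_mult by simp

text \<open>Either p divides n or the indicator e of n is 1. Multiplied by p, this reads p n e = p n
  modulo p^2, the image of [b, a] = a^p under the endomorphism of x.\<close>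

lemma residue_indicator_absorb:
  obtains t where "n * (residue_indicator p n - 1) = int p * t"
proof -
  have "int p dvd n * (residue_indicator p n - 1)" by (simp add: residue_indicator_def)
  then show ?thesis using that by (elim dvdE)
qed

lemma pow_coord_assoc:
  "pow_coord p (pow_coord p n h m mod (int p)\<^sup>2) ((h * m + residue_indicator p n * h') mod int p) l
      mod (int p)\<^sup>2 =
    pow_coord p n h (pow_coord p m h' l mod (int p)\<^sup>2) mod (int p)\<^sup>2"
proof -
  define P s \<epsilon> where "P = int p" and "s = ((int p)\<^sup>2 + 1) div 2" and "\<epsilon> = residue_indicator p n"
  define X Y H where "X = s * n * h * m * (m - 1)" and "Y = s * m * h' * l * (l - 1)"
    and "H = h * m + \<epsilon> * h'"
  obtain t where t: "n * (\<epsilon> - 1) = P * t"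
    using residue_indicator_absorb unfolding P_def \<epsilon>_def by blast
  note pc = pow_coord_def[of p, folded s_def P_def]
  have nm: "pow_coord p n h m = n * m + P * X" and ml: "pow_coord p m h' l = m * l + P * Y"
    by (simp_all add: pc X_def Y_def mult_ac)
  \<comment> \<open>To first order in P the terms with h cancel by l (m choose 2) + m^2 (l choose 2)
    = (m l choose 2), the rule (x^m)^l = x^(m l). The only other first-order term carries n
    (\<epsilon> - 1), which P divides.\<close>
  have "pow_coord p (n * m + P * X) H l - pow_coord p n h (m * l + P * Y) =
      P\<^sup>2 * (X * s * H * l * (l - 1) - s * n * h * Y * (2 * m * l - 1 + P * Y)) +
      P * (n * (\<epsilon> - 1)) * (s * m * h' * l * (l - 1))"
    unfolding pc unfolding X_def Y_def H_def by (simp add: algebra_simps power2_eq_square)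
  also have "\<dots> = P\<^sup>2 * (X * s * H * l * (l - 1) - s * n * h * Y * (2 * m * l - 1 + P * Y) +
      t * (s * m * h' * l * (l - 1)))"
    unfolding t by (simp add: algebra_simps power2_eq_square)
  finally have "[pow_coord p (pow_coord p n h m) H l = pow_coord p n h (pow_coord p m h' l)] (mod P\<^sup>2)"
    by (simp add: cong_iff_dvd_diff nm ml)
  moreover have "[pow_coord p (pow_coord p n h m mod P\<^sup>2) (H mod P) l =
      pow_coord p (pow_coord p n h m) H l] (mod P\<^sup>2)"
    unfolding P_def by (intro pow_coord_cong) simp_all
  moreover have "[pow_coord p n h (pow_coord p m h' l) =
      pow_coord p n h (pow_coord p m h' l mod P\<^sup>2)] (mod P\<^sup>2)"
    unfolding P_def by (intro pow_coord_cong) simp_all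
  ultimately show ?thesis
    unfolding cong_def P_def H_def \<epsilon>_def by metis
qed

lemma pow_coord_distrib:
  assumes "odd p"
  shows "pow_coord p n h ((m + (1 + int p * h') * l) mod (int p)\<^sup>2) mod (int p)\<^sup>2 =
    (pow_coord p n h m mod (int p)\<^sup>2 +
      (1 + int p * ((h * m + residue_indicator p n * h') mod int p)) *
      (pow_coord p n h l mod (int p)\<^sup>2)) mod (int p)\<^sup>2"
proof -
  define P s \<epsilon> where "P = int p" and "s = ((int p)\<^sup>2 + 1) div 2" and "\<epsilon> = residue_indicator p n"
  define M H where "M = m + (1 + P * h') * l" and "H = h * m + \<epsilon> * h'"
  have "even ((int p)\<^sup>2 + 1)" using assms by simp
  then have s: "2 * s - 1 = P\<^sup>2" unfolding s_def P_def
    by (metis add_diff_cancel_right' dvd_mult_div_cancel)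
  obtain t where t: "n * (\<epsilon> - 1) = P * t"
    using residue_indicator_absorb unfolding P_def \<epsilon>_def by blast
  note pc = pow_coord_def[of p, folded s_def P_def]
  let ?R = "pow_coord p n h m + (1 + P * H) * pow_coord p n h l"
  \<comment> \<open>Oddness enters here: the cross term 2 m l of (m + l)(m + l - 1) is multiplied by
    s and must match the term h m of H, which works since 2 s is 1 modulo P^2. The h' terms leave n
    (\<epsilon> - 1) again.\<close>
  have "pow_coord p n h M - ?R =
      P\<^sup>2 * (s * n * h * h' * l * (2 * (m + l) - 1 + P * h' * l) - H * s * n * h * l * (l - 1)) +
      P * n * h * m * l * (2 * s - 1) - P * (n * (\<epsilon> - 1)) * h' * l"
    unfolding pc M_def H_def by (simp add: algebra_simps power2_eq_square)
  also have "\<dots> =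
      P\<^sup>2 * (s * n * h * h' * l * (2 * (m + l) - 1 + P * h' * l) - H * s * n * h * l * (l - 1) +
        P * n * h * m * l - t * h' * l)"
    unfolding t s by (simp add: algebra_simps power2_eq_square)
  finally have "[pow_coord p n h M = ?R] (mod P\<^sup>2)"
    by (simp add: cong_iff_dvd_diff)
  moreover have "[pow_coord p n h (M mod P\<^sup>2) = pow_coord p n h M] (mod P\<^sup>2)"
    unfolding P_def by (intro pow_coord_cong) simp_all
  moreover have "(pow_coord p n h m mod P\<^sup>2 + (1 + P * (H mod P)) * (pow_coord p n h l mod P\<^sup>2))
      mod P\<^sup>2 = ?R mod P\<^sup>2"
    by (metis mod_add_eq mod_mult_right_eq mod_mod_trivial twist_factor_mod)
  ultimately show ?thesis
    unfolding cong_def P_def H_def M_def \<epsilon>_def by metis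
qed

text \<open>Modulo p the a-coordinates multiply like integers and the indicator is multiplicative.
  The b-coordinate is the same statement with h in place of k.\<close>

lemma linear_coord_assoc:
  assumes "prime p"
  shows "((k * m + residue_indicator p n * k') mod int p * l +
      residue_indicator p (pow_coord p n h m mod (int p)\<^sup>2) * k'') mod int p =
    (k * (pow_coord p m h' l mod (int p)\<^sup>2) +
      residue_indicator p n * ((k' * l + residue_indicator p m * k'') mod int p)) mod int p"
proof -
  let ?e = "residue_indicator p"
  have "[(k * m + ?e n * k') mod int p * l + ?e n * ?e m * k'' =
      (k * m + ?e n * k') * l + ?e n * ?e m * k''] (mod int p)"
    by (intro cong_add cong_mult cong_refl) simp
  also have "(k * m + ?e n * k') * l + ?e n * ?e m * k'' =
      k * (m * l) + ?e n * (k' * l + ?e m * k'')"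
    by (simp add: algebra_simps)
  also have "[\<dots> = k * (pow_coord p m h' l mod (int p)\<^sup>2) +
      ?e n * ((k' * l + ?e m * k'') mod int p)] (mod int p)"
    by (intro cong_add cong_mult cong_refl cong_sym[OF pow_coord_cong_mult]) simp
  finally show ?thesis
    by (simp add: residue_indicator_pow_coord[OF assms] cong_def)
qed

lemma linear_coord_distrib:
  "(k * ((m + (1 + int p * h) * l) mod (int p)\<^sup>2) + e * ((k' + k'') mod int p)) mod int p =
    ((k * m + e * k') mod int p + (k * l + e * k'') mod int p) mod int p"
proof -
  have "[m + (1 + int p * h) * l = m + l] (mod int p)"
    by (simp add: cong_iff_dvd_diff algebra_simps)
  then have "[(m + (1 + int p * h) * l) mod (int p)\<^sup>2 = m + l] (mod int p)"
    using cong_mod_square cong_trans by blast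
  then have "[k * ((m + (1 + int p * h) * l) mod (int p)\<^sup>2) + e * ((k' + k'') mod int p) =
      k * (m + l) + e * (k' + k'')] (mod int p)"
    by (intro cong_add cong_mult cong_refl) simp_all
  also have "k * (m + l) + e * (k' + k'') = (k * m + e * k') + (k * l + e * k'')"
    by (simp add: algebra_simps)
  finally show ?thesis by (simp add: cong_def mod_add_eq)
qed

lemma nearring_mult_closed:
  "p > 0 \<Longrightarrow> nearring_mult p x y \<in> carrier (model p)"
  by (simp add: nearring_mult_def carrier_model split: prod.split)

lemma nearring_mult_assoc:
  "prime p \<Longrightarrow> nearring_mult p (nearring_mult p x y) z = nearring_mult p x (nearring_mult p y z)"
  by (simp add: nearring_mult_def pow_coord_assoc linear_coord_assoc split: prod.split)

lemma nearring_mult_distrib: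
  assumes "odd p" "z \<in> carrier (model p)"
  shows "nearring_mult p x (y \<otimes>\<^bsub>model p\<^esub> z) =
    nearring_mult p x y \<otimes>\<^bsub>model p\<^esub> nearring_mult p x z"
proof -
  have p: "p > 0" using assms(1) by (rule odd_pos)
  obtain k n h k' m h' k'' l h'' where xyz: "x = (k, n, h)" "y = (k', m, h')" "z = (k'', l, h'')"
    by (metis prod.exhaust)
  have "l \<in> {0..<(int p)\<^sup>2}"
    using assms(2) p by (simp add: xyz carrier_model)
  moreover have "pow_coord p n h l mod (int p)\<^sup>2 \<in> {0..<(int p)\<^sup>2}"
    using p by simp
  ultimately show ?thesis
    using p by (simp only: xyz nearring_mult_def prod.case mult_model pow_coord_distrib[OF assms(1)]
        linear_coord_distrib)
qed

lemma nearring_mult_one: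
  assumes "p > 1" "x \<in> carrier (model p)"
  shows "nearring_mult p (0, 1, 0) x = x" "nearring_mult p x (0, 1, 0) = x"
  using assms
  by (auto simp: nearring_mult_def carrier_model pow_coord_def residue_indicator_def)

section \<open>Units and the subgroup of nonunits\<close>

lemma nearring_mult_right_inverse:
  assumes "prime p" "\<not> int p dvd n"
  obtains k' m h' where "(k', m, h') \<in> carrier (model p)" "\<not> int p dvd m"
    "nearring_mult p (k, n, h) (k', m, h') = (0, 1, 0)"
proof -
  have p: "p > 1" using assms(1) by (rule prime_gt_1_nat)
  then have Q: "(int p)\<^sup>2 > 1" by (simp add: one_less_power)
  define P s where "P = int p" and "s = ((int p)\<^sup>2 + 1) div 2"
  note pc = pow_coord_def[of p, folded s_def P_def]
  have "coprime n (P\<^sup>2)"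
    using assms prime_imp_coprime[of "int p" n] by (simp add: P_def coprime_commute)
  then obtain r where r: "[n * r = 1] (mod P\<^sup>2)"
    using cong_solve_coprime_int by blast
  \<comment> \<open>One Newton step: r inverts n, and replacing r by r - P Z changes n r by - P n Z,
    which cancels the term P s n h r (r - 1) of \<open>pow_coord\<close> up to multiples of
    P^2.\<close>
  define Z where "Z = s * h * r * (r - 1)"
  define m where "m = (r - P * Z) mod P\<^sup>2"
  have "pow_coord p n h (r - P * Z) - n * r =
      P\<^sup>2 * (s * n * h * (P * Z\<^sup>2 - Z * (2 * r - 1)))"
    unfolding pc Z_def by (simp add: algebra_simps power2_eq_square)
  then have "[pow_coord p n h (r - P * Z) = n * r] (mod P\<^sup>2)"
    by (simp add: cong_iff_dvd_diff)
  moreover have "[pow_coord p n h m = pow_coord p n h (r - P * Z)] (mod P\<^sup>2)"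
    unfolding m_def P_def by (intro pow_coord_cong) simp_all
  ultimately have "[pow_coord p n h m = 1] (mod P\<^sup>2)"
    using r cong_trans by blast
  then have one: "pow_coord p n h m mod P\<^sup>2 = 1"
    using Q by (simp add: cong_def P_def)
  have n: "residue_indicator p n = 1" using assms(2) by (simp add: residue_indicator_def)
  have "residue_indicator p m = 1"
    using residue_indicator_pow_coord[OF assms(1), of n h m] one n p
    by (simp add: P_def residue_indicator_def)
  then have "\<not> P dvd m" by (auto simp: residue_indicator_def P_def)
  moreover have "((- k * m) mod P, m, (- h * m) mod P) \<in> carrier (model p)"
    using p by (simp add: carrier_model m_def P_def)
  moreover have "nearring_mult p (k, n, h) ((- k * m) mod P, m, (- h * m) mod P) = (0, 1, 0)"
    using one n by (simp add: nearring_mult_def P_def mod_simps)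
  ultimately show ?thesis using that by (simp add: P_def)
qed

lemma nonunits_G5_nearring:
  assumes "prime p"
  shows "carrier (G5_nearring p) - Units (G5_nearring p) =
    {(k, n, h) \<in> carrier (model p). int p dvd n}"
proof -
  have p: "p > 1" using assms by (rule prime_gt_1_nat)
  let ?m = "nearring_mult p"
  have "(k, n, h) \<in> Units (G5_nearring p) \<longleftrightarrow> \<not> int p dvd n"
    if x: "(k, n, h) \<in> carrier (model p)" for k n h
  proof
    assume "(k, n, h) \<in> Units (G5_nearring p)"
    then obtain y where "?m (k, n, h) y = (0, 1, 0)"
      by (auto simp: Units_def G5_nearring_def)
    then obtain h' m where "pow_coord p n h m mod (int p)\<^sup>2 = 1"
      by (auto simp: nearring_mult_def split: prod.splits)
    then have "residue_indicator p n \<noteq> 0"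
      using residue_indicator_pow_coord[OF assms, of n h m] p
      by (auto simp: residue_indicator_def)
    then show "\<not> int p dvd n" by (auto simp: residue_indicator_def)
  next
    assume "\<not> int p dvd n"
    then obtain k' m h' where y: "(k', m, h') \<in> carrier (model p)" "\<not> int p dvd m"
      and xy: "?m (k, n, h) (k', m, h') = (0, 1, 0)"
      using nearring_mult_right_inverse[OF assms] by metis
    \<comment> \<open>Since p does not divide m, the right inverse y has a right inverse z of its
      own; then z equals x, so y is a two-sided inverse.\<close>
    then obtain z where z: "z \<in> carrier (model p)" and yz: "?m (k', m, h') z = (0, 1, 0)"
      using nearring_mult_right_inverse[OF assms] by metis
    have "z = ?m (?m (k, n, h) (k', m, h')) z"
      using nearring_mult_one(1)[OF p z] xy by simp
    also have "\<dots> = (k, n, h)"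
      using nearring_mult_one(2)[OF p x] yz by (simp add: nearring_mult_assoc[OF assms])
    finally show "(k, n, h) \<in> Units (G5_nearring p)"
      using x y(1) xy yz by (auto simp: Units_def G5_nearring_def)
  qed
  then show ?thesis by (auto simp: G5_nearring_def)
qed

text \<open>Modulo p the twist disappears, so n is additive there and the set is the kernel of a
  homomorphism to the integers modulo p.\<close>

lemma subgroup_model_dvd:
  assumes "p > 0"
  shows "subgroup {(k, n, h) \<in> carrier (model p). int p dvd n} (model p)"
proof -
  interpret K: group "model p" using assms by (rule group_model)
  have dvd_mod: "int p dvd x mod (int p)\<^sup>2 \<longleftrightarrow> int p dvd x" for x
    by (simp add: dvd_mod_iff)
  have mult: "x \<otimes>\<^bsub>model p\<^esub> y =
      ((fst x + fst y) mod int p,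
       (fst (snd x) + (1 + int p * snd (snd x)) * fst (snd y)) mod (int p)\<^sup>2,
       (snd (snd x) + snd (snd y)) mod int p)" if "y \<in> carrier (model p)" for x y
    using that assms by (cases x; cases y) (simp add: mult_model carrier_model)
  have L: "{(k, n, h) \<in> carrier (model p). int p dvd n} =
      {x \<in> carrier (model p). int p dvd fst (snd x)}" by auto
  show ?thesis
    unfolding L
  proof
    fix x assume x: "x \<in> {x \<in> carrier (model p). int p dvd fst (snd x)}"
    then have "x \<otimes>\<^bsub>model p\<^esub> inv\<^bsub>model p\<^esub> x = (0, 0, 0)"
      by (simp add: one_model)
    then have "(fst (snd x) + (1 + int p * snd (snd x)) * fst (snd (inv\<^bsub>model p\<^esub> x))) mod (int p)\<^sup>2 = 0"
      using x mult by simp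
    then have "int p dvd fst (snd x) + (1 + int p * snd (snd x)) * fst (snd (inv\<^bsub>model p\<^esub> x))"
      using dvd_mod by (metis dvd_0_right)
    then have "int p dvd fst (snd (inv\<^bsub>model p\<^esub> x))"
      using x by (simp add: distrib_right dvd_add_right_iff dvd_add_left_iff mult.assoc)
    then show "inv\<^bsub>model p\<^esub> x \<in> {x \<in> carrier (model p). int p dvd fst (snd x)}"
      using x by simp
  qed (use K.m_closed K.one_closed in \<open>auto simp: one_model mult dvd_mod\<close>)
qed

lemma local_nearring_G5_nearring:
  assumes "prime p" "odd p"
  shows "local_nearring (G5_nearring p)"
proof -
  have p: "p > 1" using assms(1) by (rule prime_gt_1_nat)
  then have "(int p)\<^sup>2 > 1" by (simp add: one_less_power)
  with p have one_closed: "(0, 1, 0) \<in> carrier (model p)" by (simp add: carrier_model)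
  have sel: "carrier (G5_nearring p) = carrier (model p)"
    "monoid.mult (G5_nearring p) = nearring_mult p" "one (G5_nearring p) = (0, 1, 0)"
    "add (G5_nearring p) = monoid.mult (model p)"
    by (simp_all add: G5_nearring_def)
  show ?thesis
  proof (intro local_nearring.intro nearring_with_identity.intro nearring.intro
      nearring_with_identity_axioms.intro local_nearring_axioms.intro monoidI)
    show "group (add_monoid (G5_nearring p))"
      using p unfolding add_monoid_G5_nearring by (simp add: group_model)
    show "subgroup (carrier (G5_nearring p) - Units (G5_nearring p)) (add_monoid (G5_nearring p))"
      unfolding add_monoid_G5_nearring nonunits_G5_nearring[OF assms(1)]
      using p by (simp add: subgroup_model_dvd)
  qed (use p one_closed in \<open>simp_all add: sel nearring_mult_closed nearring_mult_assoc[OF assms(1)]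
      nearring_mult_distrib[OF assms(2)] nearring_mult_one\<close>)
qed

theorem theorem5:
  fixes p :: nat
  assumes "prime p" and "odd p"
  shows "order (G5 p) = p ^ 4 \<and>
    (\<exists>\<phi> \<in> hom (integer_mod_group p) (AutoGroup (integer_mod_group (p\<^sup>2))).
       G5 p \<cong> integer_mod_group p \<times>\<times>
         semidirect_product (integer_mod_group (p\<^sup>2)) (integer_mod_group p) \<phi>) \<and>
    (\<exists>R :: (int \<times> int \<times> int) ring. local_nearring R \<and> add_monoid R \<cong> G5 p)"
proof (intro conjI)
  have p: "p > 1" using assms(1) by (rule prime_gt_1_nat)
  interpret K: group "model p" using p by (simp add: group_model)
  have iso: "model p \<cong> G5 p" by (rule model_iso_G5[OF p])
  show "order (G5 p) = p ^ 4"
    using iso_same_card[OF iso] card_model p by (simp add: order_def)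
  show "\<exists>\<phi> \<in> hom (integer_mod_group p) (AutoGroup (integer_mod_group (p\<^sup>2))).
      G5 p \<cong> integer_mod_group p \<times>\<times>
        semidirect_product (integer_mod_group (p\<^sup>2)) (integer_mod_group p) \<phi>"
    using K.iso_sym[OF iso] twist_hom[of p] p unfolding model_def by auto
  show "\<exists>R :: (int \<times> int \<times> int) ring. local_nearring R \<and> add_monoid R \<cong> G5 p"
    using local_nearring_G5_nearring[OF assms] iso by (metis add_monoid_G5_nearring)
qed

end
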